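(* Let $\tau$ and $\rho$ be primitive aperiodic substitutions with balanced growth (on finite alphabets $A$ and $B$ respectively) whose associated matrices have the same dominant eigenvalue $\lambda > 1$, and let $X_\tau^\leftrightarrow \subset A^{\mathbb{Z}}$ and $X_\rho^\leftrightarrow \subset B^{\mathbb{Z}}$ be their two-sided subshifts. Then there exists a finite set $P$ of block maps from $X_\tau^\leftrightarrow$ to $X_\rho^\leftrightarrow$ such that if $f : X_\tau^\leftrightarrow \to X_\rho^\leftrightarrow$ is a block map, then $f = \sigma^k \circ g$ for some $g \in P$ and $k \in \mathbb{Z}$.
   Context: $\mathbb{N}$ contains $0$. For a finite alphabet $A$, $A^*$ is the set of finite words, $|w|$ is the length of $w$, $|w|_b$ the number of occurrences of the letter $b$ in $w$, and $v \sqsubset w$ means that $v$ is a factor (contiguous subword) of $w$; $x_{[i,j]} = x_i x_{i+1} \cdots x_j$. The shift is $\sigma(x)_i = x_{i+1}$ on $A^{\mathbb{N}}$ or $A^{\mathbb{Z}}$. A (two-sided) subshift is a closed $X \subset A^{\mathbb{Z}}$ (product topology) with $\sigma(X) = X$. A block map between subshifts is a continuous map $f : X \to Y$ with $f \circ \sigma = \sigma \circ f$. A substitution on $A$ is a map $\tau : A^* \to A^*$ with $\tau(uv) = \tau(u)\tau(v)$. Its associated matrix is the $|A| \times |A|$ matrix whose $(a,b)$ entry is $|\tau(a)|_b$; its dominant eigenvalue is the Frobenius eigenvalue. The one-sided subshift $X_\tau \subset A^{\mathbb{N}}$ (two-sided subshift $X_\tau^\leftrightarrow \subset A^{\mathbb{Z}}$)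 of $\tau$ is the set of all $x$ in $A^{\mathbb{N}}$ (in $A^{\mathbb{Z}}$) all of whose factors are factors of $\tau^n(a)$ for some $a \in A$, $n \in \mathbb{N}$. $\tau$ is primitive if for all $a, b \in A$ we have $a \sqsubset \tau^n(b)$ for all large enough $n$; it is aperiodic if $X_\tau$ contains no $\sigma$-periodic point. A primitive aperiodic substitution $\tau$ has balanced growth if there is a real number $Z(\tau)$ such that $\lim_{n} |\tau(x_{[0,n-1]})|/n = Z(\tau)$ for all $x \in X_\tau$, and there is a constant $D$ such that $|\tau(x_{[0,n-1]})| \in [Z(\tau) n - D, Z(\tau) n + D]$ for all $x \in X_\tau$ and $n \in \mathbb{N}$. *)

theory Defs
  imports "HOL-Analysis.Analysis" "HOL-Library.Sublist"
begin

text \<open>A finite alphabet is a type of class \<open>finite\<close>, a word is a list over it, and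
  \<open>v\<close> is a factor of \<open>w\<close> iff \<open>sublist v w\<close>.  Iterates \<open>\<tau>\<^sup>n\<close> are written \<open>\<tau> ^^ n\<close>.\<close>

definition substitution :: "('a list \<Rightarrow> 'a list) \<Rightarrow> bool" where
  "substitution \<tau> \<longleftrightarrow> (\<forall>u v. \<tau> (u @ v) = \<tau> u @ \<tau> v)"

definition primitive_subst :: "('a list \<Rightarrow> 'a list) \<Rightarrow> bool" where
  "primitive_subst \<tau> \<longleftrightarrow> (\<forall>a b. \<forall>\<^sub>F n in sequentially. sublist [a] ((\<tau> ^^ n) [b]))"

text \<open>Row \<open>a\<close>, column \<open>b\<close> holds the number of occurrences of \<open>b\<close> in \<open>\<tau>(a)\<close>; the entries are
  taken in \<open>\<complex>\<close> so that all eigenvalues are available.\<close>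

definition subst_matrix :: "('a::finite list \<Rightarrow> 'a list) \<Rightarrow> complex ^ 'a ^ 'a" where
  "subst_matrix \<tau> = (\<chi> a b. of_nat (count_list (\<tau> [a]) b))"

definition is_eigenvalue :: "complex ^ 'n ^ 'n \<Rightarrow> complex \<Rightarrow> bool" where
  "is_eigenvalue M \<mu> \<longleftrightarrow> (\<exists>v. v \<noteq> 0 \<and> M *v v = \<mu> *s v)"

text \<open>The Frobenius eigenvalue: a real eigenvalue of maximal modulus (hence nonnegative and
  unique).  Strict dominance is not demanded; for matrices of primitive substitutions it is a
  consequence of the Perron--Frobenius theorem.\<close>

definition dominant_eigenvalue :: "complex ^ 'n ^ 'n \<Rightarrow> real \<Rightarrow> bool" where
  "dominant_eigenvalue M r \<longleftrightarrow>
     is_eigenvalue M (complex_of_real r) \<and> (\<forall>\<mu>. is_eigenvalue M \<mu> \<longrightarrow> cmod \<mu> \<le> r)"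

text \<open>The index type is \<open>nat\<close> for one-sided and \<open>int\<close> for two-sided sequences.\<close>

definition shift :: "('i::{plus,one} \<Rightarrow> 'a) \<Rightarrow> 'i \<Rightarrow> 'a" where
  "shift x = (\<lambda>i. x (i + 1))"

text \<open>On two-sided sequences the shift is invertible; this is its \<open>k\<close>-th power for \<open>k \<in> \<int>\<close>.\<close>

definition shift_power :: "int \<Rightarrow> (int \<Rightarrow> 'a) \<Rightarrow> int \<Rightarrow> 'a" where
  "shift_power k x = (\<lambda>i. x (i + k))"

lemma shift_power_0: "shift_power 0 = id"
  by (simp add: shift_power_def fun_eq_iff)

lemma shift_power_1: "shift_power 1 = shift"
  by (simp add: shift_power_def shift_def fun_eq_iff)

lemma shift_power_add: "shift_power (k + l) = shift_power k \<circ> shift_power l"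
  by (simp add: shift_power_def fun_eq_iff algebra_simps)

definition one_sided_subshift :: "('a list \<Rightarrow> 'a list) \<Rightarrow> (nat \<Rightarrow> 'a) set" where
  "one_sided_subshift \<tau> = {x. \<forall>i j. \<exists>a n. sublist (map x [i..<j]) ((\<tau> ^^ n) [a])}"

definition two_sided_subshift :: "('a list \<Rightarrow> 'a list) \<Rightarrow> (int \<Rightarrow> 'a) set" where
  "two_sided_subshift \<tau> = {x. \<forall>i j. \<exists>a n. sublist (map x [i..j]) ((\<tau> ^^ n) [a])}"

definition aperiodic_subst :: "('a list \<Rightarrow> 'a list) \<Rightarrow> bool" where
  "aperiodic_subst \<tau> \<longleftrightarrow> \<not> (\<exists>x\<in>one_sided_subshift \<tau>. \<exists>p>0. (shift ^^ p) x = x)"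

definition balanced_growth :: "('a list \<Rightarrow> 'a list) \<Rightarrow> bool" where
  "balanced_growth \<tau> \<longleftrightarrow>
     (\<exists>Z::real.
        (\<forall>x\<in>one_sided_subshift \<tau>.
           (\<lambda>n. real (length (\<tau> (map x [0..<n]))) / real n) \<longlonglongrightarrow> Z) \<and>
        (\<exists>D::real. \<forall>x\<in>one_sided_subshift \<tau>. \<forall>n.
           real (length (\<tau> (map x [0..<n]))) \<in> {Z * real n - D .. Z * real n + D}))"

definition full_shift_topology :: "(int \<Rightarrow> 'a) topology" where
  "full_shift_topology = product_topology (\<lambda>_. discrete_topology UNIV) UNIV"

text \<open>Block maps are total functions of which only the values on \<open>X\<close> matter.\<close>

definition block_map ::
  "(int \<Rightarrow> 'a) set \<Rightarrow> (int \<Rightarrow> 'b) set \<Rightarrow> ((int \<Rightarrow> 'a) \<Rightarrow> (int \<Rightarrow> 'b)) \<Rightarrow> bool" where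
  "block_map X Y f \<longleftrightarrow>
     continuous_map (subtopology full_shift_topology X) (subtopology full_shift_topology Y) f \<and>
     (\<forall>x\<in>X. f (shift x) = shift (f x))"

end

theory Submission
  imports Defs
begin

text \<open>
  Write \<open>X\<close> and \<open>Y\<close> for the two subshifts.  By primitivity \<open>X\<close> is linearly recurrent (every word
  of length \<open>n\<close> of \<open>X\<close> occurs in every word of length \<open>K n\<close>) and \<open>Y\<close> has at most \<open>C n\<close> words of
  length \<open>n\<close>.  Let \<open>F\<close> be a finite set of block maps with common radius \<open>R\<close>, put \<open>m = 2 R + 1\<close> and
  \<open>L = 2 K m\<close>, and fix a point \<open>x\<close> of \<open>X\<close>.  If \<open>|F| > 2 C K\<close>, two of the \<open>|F| m\<close> words
  \<open>f(x)\<^bsub>[k, k+L-1]\<^esub>\<close> with \<open>f \<in> F\<close>, \<open>k < m\<close> coincide.  The two corresponding maps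
  \<open>\<sigma>\<^sup>k \<circ> f\<close> and \<open>\<sigma>\<^sup>l \<circ> g\<close> agree on a piece of \<open>x\<close> that contains all words long enough to determine
  them, so they are equal.  As \<open>Y\<close> has no periodic points, \<open>f \<noteq> g\<close>.  Hence there are at most
  \<open>2 C K\<close> block maps up to powers of the shift.
\<close>

section \<open>Words at a position, and block maps up to powers of the shift\<close>

definition window :: "(int \<Rightarrow> 'a) \<Rightarrow> int \<Rightarrow> nat \<Rightarrow> 'a list" where
  "window x i n = map (\<lambda>t. x (i + int t)) [0..<n]"

lemma length_window [simp]: "length (window x i n) = n"
  by (simp add: window_def)

lemma window_eq_map_upto: "window x i n = map x [i..i + int n - 1]"
  by (rule nth_equalityI) (auto simp: window_def nth_upto)

text \<open>Restricted to points of \<open>X\<close>, because block maps are total functions whose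
  values elsewhere are arbitrary.\<close>

definition shift_equivalent ::
  "(int \<Rightarrow> 'a) set \<Rightarrow> ((int \<Rightarrow> 'a) \<Rightarrow> (int \<Rightarrow> 'b)) \<Rightarrow> ((int \<Rightarrow> 'a) \<Rightarrow> (int \<Rightarrow> 'b)) \<Rightarrow> bool" where
  "shift_equivalent X f g \<longleftrightarrow> (\<exists>k. \<forall>x\<in>X. f x = shift_power k (g x))"

lemma shift_equivalent_sym: "shift_equivalent X f g \<Longrightarrow> shift_equivalent X g f"
  unfolding shift_equivalent_def
proof (elim exE)
  fix k assume "\<forall>x\<in>X. f x = shift_power k (g x)"
  then have "\<forall>x\<in>X. g x = shift_power (- k) (f x)"
    by (simp add: shift_power_def)
  then show "\<exists>k. \<forall>x\<in>X. g x = shift_power k (f x)" ..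
qed


section \<open>Primitive substitutions\<close>

locale primitive_substitution =
  fixes \<tau> :: "'a::finite list \<Rightarrow> 'a list"
  assumes subst: "substitution \<tau>" and primitive: "primitive_subst \<tau>"
begin

text \<open>This may exceed the set of words occurring in the two-sided subshift: for the identity
  on a one-letter alphabet the subshift is empty, while this set contains the letter.\<close>

definition language :: "'a list set" where
  "language = {u. \<exists>a n. sublist u ((\<tau> ^^ n) [a])}"

lemma power_append: "(\<tau> ^^ n) (u @ v) = (\<tau> ^^ n) u @ (\<tau> ^^ n) v"
  using subst by (induction n) (auto simp: substitution_def)

lemma power_Nil: "(\<tau> ^^ n) [] = []"
  using power_append[of n "[]" "[]"] by simp

lemma power_Cons: "(\<tau> ^^ n) (a # w) = (\<tau> ^^ n) [a] @ (\<tau> ^^ n) w"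
  using power_append[of n "[a]" w] by simp

lemma power_sublist:
  assumes "sublist u v"
  shows "sublist ((\<tau> ^^ n) u) ((\<tau> ^^ n) v)"
proof -
  obtain ps ss where "v = ps @ u @ ss"
    using assms by (auto simp: sublist_def)
  then show ?thesis
    by (simp add: power_append sublist_append)
qed

lemma length_power_le:
  assumes "\<And>a. length ((\<tau> ^^ n) [a]) \<le> M"
  shows "length ((\<tau> ^^ n) w) \<le> M * length w"
proof (induction w)
  case (Cons a w)
  then show ?case using assms[of a] by (subst power_Cons) simp
qed (simp add: power_Nil)

lemma length_power_bounded: "\<exists>M. \<forall>a. length ((\<tau> ^^ n) [a]) \<le> M"
proof
  show "\<forall>a. length ((\<tau> ^^ n) [a]) \<le> Max (range (\<lambda>a. length ((\<tau> ^^ n) [a])))"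
    by simp
qed

text \<open>If \<open>u\<close> lies in the \<open>k\<close>-th iterate of \<open>a\<close>, then it
  lies in the \<open>n\<close>-th iterate of \<open>b\<close> as soon as \<open>a\<close> occurs in
  the iterate of order \<open>n - k\<close>. Finiteness of the alphabet makes the threshold
  independent of \<open>b\<close>.\<close>

lemma language_uniform:
  assumes "u \<in> language"
  shows "\<forall>\<^sub>F n in sequentially. \<forall>b. sublist u ((\<tau> ^^ n) [b])"
proof (rule eventually_all_finite)
  fix b
  obtain a k where ak: "sublist u ((\<tau> ^^ k) [a])"
    using assms by (auto simp: language_def)
  obtain N where N: "\<And>n. n \<ge> N \<Longrightarrow> sublist [a] ((\<tau> ^^ n) [b])"
    using primitive by (force simp: primitive_subst_def eventually_sequentially)
  have "sublist u ((\<tau> ^^ n) [b])" if "n \<ge> N + k" for n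
  proof -
    have "sublist ((\<tau> ^^ k) [a]) ((\<tau> ^^ k) ((\<tau> ^^ (n - k)) [b]))"
      by (intro power_sublist N) (use that in simp)
    also have "(\<tau> ^^ k) ((\<tau> ^^ (n - k)) [b]) = (\<tau> ^^ n) [b]"
      using that by (metis add_leD2 comp_apply funpow_add le_add_diff_inverse)
    finally show ?thesis
      using ak sublist_order.order_trans by blast
  qed
  then show "\<forall>\<^sub>F n in sequentially. sublist u ((\<tau> ^^ n) [b])"
    by (auto simp: eventually_sequentially)
qed

text \<open>Desubstitution to any order \<open>n\<close>: a high iterate \<open>n + N\<close> that
  contains \<open>u\<close> is read as the \<open>n\<close>-th iterate of the word
  \<open>(\<tau> ^^ N) [b]\<close>.\<close>

lemma language_in_iterate:
  assumes "u \<in> language"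
  obtains w where "w \<in> language" and "sublist u ((\<tau> ^^ n) w)"
proof -
  obtain N where "\<And>k b. k \<ge> N \<Longrightarrow> sublist u ((\<tau> ^^ k) [b])"
    using language_uniform[OF assms] by (auto simp: eventually_sequentially)
  then have "sublist u ((\<tau> ^^ (n + N)) [b])" for b
    by simp
  then have "sublist u ((\<tau> ^^ n) ((\<tau> ^^ N) [b]))" for b
    by (simp add: funpow_add)
  moreover have "(\<tau> ^^ N) [b] \<in> language" for b
    by (auto simp: language_def)
  ultimately show thesis
    using that by blast
qed

lemma language_sublist:
  assumes "w \<in> language" and "sublist v w"
  shows "v \<in> language"
  using assms sublist_order.order_trans by (fastforce simp: language_def)

section \<open>Lengths and factors of the blocks \<open>(\<tau> ^^ n) [a]\<close>\<close>

text \<open>Iterates commute. With \<open>p\<close> such that every letter occurs in every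
  \<open>(\<tau> ^^ p) [b]\<close>, the \<open>n\<close>-block of \<open>a\<close> is a factor of
  the \<open>p\<close>-th iterate of the \<open>n\<close>-block of \<open>b\<close>, and a fixed
  iterate stretches lengths by a bounded factor.\<close>

lemma lengths_comparable: "\<exists>Q>0. \<forall>n a b. length ((\<tau> ^^ n) [a]) \<le> Q * length ((\<tau> ^^ n) [b])"
proof -
  have "[a] \<in> language" for a
    by (auto simp: language_def intro!: exI[of _ a] exI[of _ 0])
  then have "\<forall>\<^sub>F p in sequentially. \<forall>a b. sublist [a] ((\<tau> ^^ p) [b])"
    by (intro eventually_all_finite language_uniform)
  then obtain p where p: "\<And>a b. sublist [a] ((\<tau> ^^ p) [b])"
    by (auto simp: eventually_sequentially)
  obtain Q where Q: "\<And>a. length ((\<tau> ^^ p) [a]) \<le> Q"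
    using length_power_bounded by blast
  have "length ((\<tau> ^^ n) [a]) \<le> Q * length ((\<tau> ^^ n) [b])" for n a b
  proof -
    have "length ((\<tau> ^^ n) [a]) \<le> length ((\<tau> ^^ n) ((\<tau> ^^ p) [b]))"
      by (intro sublist_length_le power_sublist p)
    also have "(\<tau> ^^ n) ((\<tau> ^^ p) [b]) = (\<tau> ^^ p) ((\<tau> ^^ n) [b])"
      by (metis add.commute comp_apply funpow_add)
    also have "length \<dots> \<le> Q * length ((\<tau> ^^ n) [b])"
      by (rule length_power_le[OF Q])
    finally show ?thesis .
  qed
  moreover from this[of 0] have "Q > 0"
    by (cases Q) auto
  ultimately show ?thesis by blast
qed

text \<open>A word no longer than any block meets at most two consecutive blocks.\<close>

lemma short_factor_of_iterate:
  assumes "sublist u ((\<tau> ^^ n) w)" and "\<And>a. length u \<le> length ((\<tau> ^^ n) [a])"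
  shows "\<exists>v. sublist v w \<and> length v \<le> 2 \<and> sublist u ((\<tau> ^^ n) v)"
  using assms(1)
proof (induction w)
  case Nil
  then show ?case by (intro exI[of _ "[]"]) simp
next
  case (Cons a w)
  then consider "sublist u ((\<tau> ^^ n) [a])" | "sublist u ((\<tau> ^^ n) w)"
    | u1 u2 where "u = u1 @ u2" "suffix u1 ((\<tau> ^^ n) [a])" "prefix u2 ((\<tau> ^^ n) w)"
    by (subst (asm) (2) power_Cons) (auto simp: sublist_append)
  then show ?case
  proof cases
    case 1
    then show ?thesis by (intro exI[of _ "[a]"]) (auto simp: sublist_Cons_right)
  next
    case 2
    then show ?thesis using Cons.IH by (meson sublist_Cons_right)
  next
    case 3
    show ?thesis
    proof (cases w)
      case Nil
      then have "sublist u ((\<tau> ^^ n) [a])"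
        using 3 by (simp add: power_Nil suffix_imp_sublist)
      then show ?thesis by (intro exI[of _ "[a]"]) (auto simp: sublist_Cons_right)
    next
      case w: (Cons b w')
      have "prefix u2 ((\<tau> ^^ n) [b])"
      proof (rule prefix_length_prefix)
        show "prefix u2 ((\<tau> ^^ n) w)" by fact
        show "prefix ((\<tau> ^^ n) [b]) ((\<tau> ^^ n) w)"
          unfolding w by (subst (2) power_Cons) simp
        show "length u2 \<le> length ((\<tau> ^^ n) [b])"
          using assms(2)[of b] 3 by simp
      qed
      then have "sublist u ((\<tau> ^^ n) [a, b])"
        using 3 power_Cons[of n a "[b]"] by (auto simp: sublist_append)
      moreover have "sublist [a, b] (a # w)"
        by (simp add: w)
      ultimately show ?thesis
        by (intro exI[of _ "[a, b]"]) simp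
    qed
  qed
qed

text \<open>A word twice as long as every block must contain a whole block.\<close>

lemma long_factor_of_iterate:
  assumes "sublist u ((\<tau> ^^ n) w)" and "\<And>a. length ((\<tau> ^^ n) [a]) \<le> M"
    and "M > 0" and "length u \<ge> 2 * M"
  shows "\<exists>a. sublist ((\<tau> ^^ n) [a]) u"
  using assms(1)
proof (induction w)
  case Nil
  then show ?case using assms(3,4) by (simp add: power_Nil)
next
  case (Cons a w)
  then consider "sublist u ((\<tau> ^^ n) [a])" | "sublist u ((\<tau> ^^ n) w)"
    | u1 u2 where "u = u1 @ u2" "suffix u1 ((\<tau> ^^ n) [a])" "prefix u2 ((\<tau> ^^ n) w)"
    by (subst (asm) (2) power_Cons) (auto simp: sublist_append)
  then show ?case
  proof cases
    case 1
    then show ?thesis using assms(2)[of a] assms(3,4) sublist_length_le by fastforce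
  next
    case 2
    then show ?thesis by (rule Cons.IH)
  next
    case 3
    \<comment> \<open>The first block takes up at most half of \<open>u\<close>, so the remainder is
      long enough to cover the next block.\<close>
    have "length u1 \<le> M"
      using suffix_length_le[OF 3(2)] assms(2)[of a] by simp
    then have u2: "length u2 \<ge> M"
      using 3(1) assms(4) by simp
    then obtain b w' where w: "w = b # w'"
      using 3(3) assms(3) by (cases w) (auto simp: power_Nil)
    have "prefix ((\<tau> ^^ n) [b]) u2"
    proof (rule prefix_length_prefix)
      show "prefix ((\<tau> ^^ n) [b]) ((\<tau> ^^ n) w)"
        unfolding w by (subst (2) power_Cons) simp
      show "prefix u2 ((\<tau> ^^ n) w)" by fact
      show "length ((\<tau> ^^ n) [b]) \<le> length u2"
        using assms(2)[of b] u2 by simp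
    qed
    then have "sublist ((\<tau> ^^ n) [b]) u"
      using 3(1) by (simp add: prefix_imp_sublist sublist_append)
    then show ?thesis ..
  qed
qed

lemma window_in_language:
  assumes "x \<in> two_sided_subshift \<tau>"
  shows "window x i n \<in> language"
  using assms by (simp add: two_sided_subshift_def language_def window_eq_map_upto)

text \<open>Take the least \<open>n\<close> for which all blocks have length at least
  \<open>W\<close>. One order lower some block is shorter than \<open>W\<close>, hence all are
  shorter than \<open>Q * W\<close>, and one more application costs a factor
  \<open>S\<close>.\<close>

lemma iterate_of_given_length:
  assumes "two_sided_subshift \<tau> \<noteq> {}"
  shows "\<exists>C. \<forall>W\<ge>1. \<exists>n. \<forall>a. W \<le> length ((\<tau> ^^ n) [a]) \<and> length ((\<tau> ^^ n) [a]) \<le> C * W"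
proof -
  obtain Q where Q: "Q > 0" "\<And>n a b. length ((\<tau> ^^ n) [a]) \<le> Q * length ((\<tau> ^^ n) [b])"
    using lengths_comparable by blast
  obtain S where S: "\<And>a. length ((\<tau> ^^ 1) [a]) \<le> S"
    using length_power_bounded by blast
  obtain x where x: "x \<in> two_sided_subshift \<tau>"
    using assms by blast
  \<comment> \<open>Growth comes from the existence of a point: its words of length
    \<open>Q * W\<close> lie in blocks, and comparability passes from one long block to all blocks
    of that order.\<close>
  have ex: "\<exists>n. \<forall>a. W \<le> length ((\<tau> ^^ n) [a])" for W
  proof -
    have "window x 0 (Q * W) \<in> language"
      by (rule window_in_language[OF x])
    then obtain b n where "sublist (window x 0 (Q * W)) ((\<tau> ^^ n) [b])"
      by (auto simp: language_def)
    then have "Q * W \<le> length ((\<tau> ^^ n) [b])"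
      using sublist_length_le by fastforce
    also have "\<dots> \<le> Q * length ((\<tau> ^^ n) [a])" for a
      by (rule Q)
    finally show ?thesis using Q(1) by auto
  qed
  have "\<exists>n. \<forall>a. W \<le> length ((\<tau> ^^ n) [a]) \<and> length ((\<tau> ^^ n) [a]) \<le> (S * Q + 1) * W"
    if W: "W \<ge> 1" for W
  proof -
    define n where "n = (LEAST n. \<forall>a. W \<le> length ((\<tau> ^^ n) [a]))"
    have lower: "\<forall>a. W \<le> length ((\<tau> ^^ n) [a])"
      unfolding n_def by (rule LeastI_ex[OF ex])
    have "length ((\<tau> ^^ n) [a]) \<le> (S * Q + 1) * W" for a
    proof (cases n)
      \<comment> \<open>Blocks of order 0 have length 1; the summand 1 in \<open>S * Q + 1\<close>
        covers them.\<close>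
      case 0
      then show ?thesis using W by simp
    next
      case (Suc k)
      then have "\<not> (\<forall>a. W \<le> length ((\<tau> ^^ k) [a]))"
        using not_less_Least[of k "\<lambda>n. \<forall>a. W \<le> length ((\<tau> ^^ n) [a])"] by (simp add: n_def)
      then obtain b where b: "length ((\<tau> ^^ k) [b]) < W"
        by (auto simp: not_le)
      have "length ((\<tau> ^^ n) [a]) = length ((\<tau> ^^ 1) ((\<tau> ^^ k) [a]))"
        by (simp add: Suc)
      also have "\<dots> \<le> S * length ((\<tau> ^^ k) [a])"
        by (rule length_power_le[OF S])
      also have "\<dots> \<le> S * (Q * W)"
        using Q(2)[of k a b] b by (intro mult_le_mono2) (meson le_trans less_imp_le mult_le_mono2)
      finally show ?thesis by (simp add: algebra_simps)
    qed
    with lower show ?thesis by blast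
  qed
  then show ?thesis by blast
qed

section \<open>Linear recurrence, linear complexity and aperiodicity\<close>

text \<open>A word of length \<open>W\<close> lies in the image of at most two letters under a
  suitable order \<open>n\<close>. Raising the order by a \<open>p\<close> independent of
  \<open>W\<close> puts it into every block, and these blocks still have length linear in
  \<open>W\<close>.\<close>

lemma linear_recurrence:
  "\<exists>K. \<forall>W\<ge>1. \<forall>x\<in>two_sided_subshift \<tau>. \<forall>y\<in>two_sided_subshift \<tau>.
     sublist (window y 0 W) (window x 0 (K * W))"
proof (cases "two_sided_subshift \<tau> = {}")
  case False
  then obtain C where C: "\<And>W. W \<ge> 1 \<Longrightarrow>
      \<exists>n. \<forall>a. W \<le> length ((\<tau> ^^ n) [a]) \<and> length ((\<tau> ^^ n) [a]) \<le> C * W"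
    using iterate_of_given_length by blast
  have "finite {v :: 'a list. length v \<le> 2}"
    using finite_lists_length_le[of "UNIV :: 'a set" 2] by simp
  then have "finite {v \<in> language. length v \<le> 2}"
    by (rule rev_finite_subset) auto
  then have "\<forall>\<^sub>F p in sequentially. \<forall>v\<in>{v \<in> language. length v \<le> 2}. \<forall>c. sublist v ((\<tau> ^^ p) [c])"
    by (rule eventually_ball_finite) (auto intro: language_uniform)
  then obtain p where p: "\<And>v c. v \<in> language \<Longrightarrow> length v \<le> 2 \<Longrightarrow> sublist v ((\<tau> ^^ p) [c])"
    by (auto simp: eventually_sequentially)
  obtain S where S: "\<And>a. length ((\<tau> ^^ p) [a]) \<le> S"
    using length_power_bounded by blast
  \<comment> \<open>Blocks of order \<open>n + p\<close> have length at most
    \<open>C * S * W\<close>; the 1 keeps the bound positive, and the factor 2 forces a whole block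
    into the window.\<close>
  have "sublist (window y 0 W) (window x 0 ((2 * (C * S + 1)) * W))"
    if W: "W \<ge> 1" and x: "x \<in> two_sided_subshift \<tau>" and y: "y \<in> two_sided_subshift \<tau>" for W x y
  proof -
    obtain n where n: "\<And>a. W \<le> length ((\<tau> ^^ n) [a])" "\<And>a. length ((\<tau> ^^ n) [a]) \<le> C * W"
      using C[OF W] by blast
    obtain w where w: "w \<in> language" "sublist (window y 0 W) ((\<tau> ^^ n) w)"
      using language_in_iterate window_in_language[OF y] by metis
    then obtain v where v: "sublist v w" "length v \<le> 2" "sublist (window y 0 W) ((\<tau> ^^ n) v)"
      using short_factor_of_iterate[of "window y 0 W" n w] n by auto
    have "sublist v ((\<tau> ^^ p) [c])" for c
      using p language_sublist v w by blast
    then have uc: "sublist (window y 0 W) ((\<tau> ^^ (n + p)) [c])" for c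
      using power_sublist[of v "(\<tau> ^^ p) [c]" n] v(3) sublist_order.order_trans
      by (fastforce simp: funpow_add)
    obtain w' where w': "sublist (window x 0 ((2 * (C * S + 1)) * W)) ((\<tau> ^^ (n + p)) w')"
      using language_in_iterate window_in_language[OF x] by metis
    have "\<exists>c. sublist ((\<tau> ^^ (n + p)) [c]) (window x 0 ((2 * (C * S + 1)) * W))"
    proof (rule long_factor_of_iterate[OF w'])
      fix a
      have "length ((\<tau> ^^ n) ((\<tau> ^^ p) [a])) \<le> C * W * length ((\<tau> ^^ p) [a])"
        by (rule length_power_le[OF n(2)])
      also have "\<dots> \<le> C * W * S"
        by (intro mult_le_mono2 S)
      finally show "length ((\<tau> ^^ (n + p)) [a]) \<le> (C * S + 1) * W"
        by (simp add: funpow_add algebra_simps)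
    qed (use W in \<open>auto simp: algebra_simps\<close>)
    then show ?thesis
      using uc sublist_order.order_trans by blast
  qed
  then show ?thesis by blast
qed simp

text \<open>A word of length \<open>L\<close> is determined by a word \<open>v\<close> of at most
  two letters and an offset in its image, which has length at most \<open>2 * C * L\<close>.\<close>

lemma linear_complexity:
  "\<exists>C. \<forall>L\<ge>1. card ((\<lambda>x. window x 0 L) ` two_sided_subshift \<tau>) \<le> C * L"
proof (cases "two_sided_subshift \<tau> = {}")
  case False
  then obtain C where C: "\<And>W. W \<ge> 1 \<Longrightarrow>
      \<exists>n. \<forall>a. W \<le> length ((\<tau> ^^ n) [a]) \<and> length ((\<tau> ^^ n) [a]) \<le> C * W"
    using iterate_of_given_length by blast
  define V where "V = {v :: 'a list. length v \<le> 2}"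
  have V: "finite V"
    using finite_lists_length_le[of "UNIV :: 'a set" 2] by (simp add: V_def)
  have "card ((\<lambda>x. window x 0 L) ` two_sided_subshift \<tau>) \<le> card V * (2 * C + 1) * L"
    if L: "L \<ge> 1" for L
  proof -
    obtain n where n: "\<And>a. L \<le> length ((\<tau> ^^ n) [a])" "\<And>a. length ((\<tau> ^^ n) [a]) \<le> C * L"
      using C[OF L] by blast
    have "(\<lambda>x. window x 0 L) ` two_sided_subshift \<tau> \<subseteq>
        (\<lambda>(v, i). take L (drop i ((\<tau> ^^ n) v))) ` (V \<times> {..2 * C * L})"
    proof clarify
      fix x assume x: "x \<in> two_sided_subshift \<tau>"
      obtain w where "sublist (window x 0 L) ((\<tau> ^^ n) w)"
        using language_in_iterate window_in_language[OF x] by metis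
      then obtain v where v: "length v \<le> 2" "sublist (window x 0 L) ((\<tau> ^^ n) v)"
        using short_factor_of_iterate[of "window x 0 L" n w] n by auto
      then obtain ps ss where ps: "(\<tau> ^^ n) v = ps @ window x 0 L @ ss"
        by (auto simp: sublist_def)
      have "length ps \<le> length ((\<tau> ^^ n) v)"
        by (simp add: ps)
      also have "\<dots> \<le> C * L * length v"
        by (rule length_power_le[OF n(2)])
      also have "\<dots> \<le> C * L * 2"
        by (intro mult_le_mono2 v)
      finally have "(v, length ps) \<in> V \<times> {..2 * C * L}"
        using v by (simp add: V_def)
      moreover have "window x 0 L = take L (drop (length ps) ((\<tau> ^^ n) v))"
        by (simp add: ps)
      ultimately show "window x 0 L \<in>
          (\<lambda>(v, i). take L (drop i ((\<tau> ^^ n) v))) ` (V \<times> {..2 * C * L})"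
        by (intro rev_image_eqI[of "(v, length ps)"]) auto
    qed
    then have "card ((\<lambda>x. window x 0 L) ` two_sided_subshift \<tau>) \<le> card (V \<times> {..2 * C * L})"
      by (rule surj_card_le[rotated]) (use V in simp)
    also have "\<dots> = card V * (2 * C * L + 1)"
      by (simp add: card_cartesian_product)
    also have "\<dots> \<le> card V * (2 * C * L + L)"
      using L by (intro mult_le_mono2) simp
    finally show ?thesis by (simp add: algebra_simps)
  qed
  then show ?thesis by blast
qed simp

lemma finite_windows: "finite ((\<lambda>x. window x 0 L) ` two_sided_subshift \<tau>)"
  by (rule finite_subset[OF _ finite_lists_length_eq[of UNIV L]]) auto

text \<open>The nonnegative half of \<open>y\<close> would be a periodic point of the one-sided
  subshift; its period is the absolute value of \<open>c\<close>.\<close>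

lemma two_sided_aperiodic:
  assumes "aperiodic_subst \<tau>" and y: "y \<in> two_sided_subshift \<tau>" and "shift_power c y = y"
  shows "c = 0"
proof (rule ccontr)
  assume "c \<noteq> 0"
  have per: "y (i + c) = y i" for i
    using assms(3) by (metis shift_power_def)
  have "y (i + \<bar>c\<bar>) = y i" for i
    using per[of i] per[of "i - c"] by (cases "c \<ge> 0") auto
  define x where "x = (\<lambda>n. y (int n))"
  have "map x [i..<j] = map y [int i..int j - 1]" for i j
    by (rule nth_equalityI) (auto simp: x_def nth_upto)
  then have "x \<in> one_sided_subshift \<tau>"
    using y by (simp add: one_sided_subshift_def two_sided_subshift_def)
  moreover have "(shift ^^ p) x = (\<lambda>i. x (i + p))" for p
    by (induction p) (auto simp: shift_def)
  then have "(shift ^^ nat \<bar>c\<bar>) x = x"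
    using \<open>\<And>i. y (i + \<bar>c\<bar>) = y i\<close> by (auto simp: x_def)
  moreover have "nat \<bar>c\<bar> > 0"
    using \<open>c \<noteq> 0\<close> by simp
  ultimately show False
    using assms(1) unfolding aperiodic_subst_def by blast
qed

end


section \<open>Block maps\<close>

lemma shift_power_two_sided_subshift:
  assumes "x \<in> two_sided_subshift \<tau>"
  shows "shift_power k x \<in> two_sided_subshift \<tau>"
proof -
  have "map (shift_power k x) [i..j] = map x [i + k..j + k]" for i j
    by (rule nth_equalityI) (auto simp: shift_power_def nth_upto algebra_simps)
  then show ?thesis
    using assms by (simp add: two_sided_subshift_def)
qed

section \<open>Topology of the full shift\<close>

lemma topspace_full_shift [simp]: "topspace full_shift_topology = UNIV"
  by (simp add: full_shift_topology_def)

lemma openin_full_shift_cylinder: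
  assumes "finite I"
  shows "openin full_shift_topology {x. \<forall>i\<in>I. x i \<in> U i}"
proof -
  have "{x. \<forall>i\<in>I. x i \<in> U i} = (\<Pi>\<^sub>E i\<in>UNIV. if i \<in> I then U i else UNIV)"
    by (auto simp: PiE_iff split: if_splits)
  also have "openin full_shift_topology \<dots>"
    unfolding full_shift_topology_def openin_PiE_gen
    using assms by (auto intro!: finite_subset[OF _ assms])
  finally show ?thesis .
qed

lemma compact_full_shift: "compact_space (full_shift_topology :: (int \<Rightarrow> 'a::finite) topology)"
  unfolding full_shift_topology_def
  by (simp add: compact_space_product_topology compact_space_discrete_topology)

text \<open>A point outside shows a forbidden word on some interval, and so does its whole cylinder
  over that interval.\<close>

lemma closedin_two_sided_subshift: "closedin full_shift_topology (two_sided_subshift \<tau>)"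
proof -
  have "\<exists>T. openin full_shift_topology T \<and> x \<in> T \<and> T \<subseteq> - two_sided_subshift \<tau>"
    if x: "x \<in> - two_sided_subshift \<tau>" for x
  proof -
    obtain i j where ij: "\<not> (\<exists>a n. sublist (map x [i..j]) ((\<tau> ^^ n) [a]))"
      using x by (auto simp: two_sided_subshift_def)
    define T where "T = {z. \<forall>k\<in>{i..j}. z k \<in> {x k}}"
    have "openin full_shift_topology T"
      unfolding T_def by (rule openin_full_shift_cylinder) simp
    moreover have "T \<subseteq> - two_sided_subshift \<tau>"
    proof
      fix z assume "z \<in> T"
      then have "map z [i..j] = map x [i..j]"
        by (simp add: T_def)
      then have "\<not> (\<exists>a n. sublist (map z [i..j]) ((\<tau> ^^ n) [a]))"
        using ij by (simp only: not_False_eq_True)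
      then show "z \<in> - two_sided_subshift \<tau>"
        unfolding two_sided_subshift_def by blast
    qed
    ultimately show ?thesis
      by (auto simp: T_def)
  qed
  then have "openin full_shift_topology (- two_sided_subshift \<tau>)"
    by (subst openin_subopen) blast
  then show ?thesis
    by (simp add: closedin_def Compl_eq_Diff_UNIV)
qed

section \<open>Block maps as sliding block codes\<close>

definition agree :: "nat \<Rightarrow> (int \<Rightarrow> 'a) \<Rightarrow> (int \<Rightarrow> 'a) \<Rightarrow> bool" where
  "agree R x y \<longleftrightarrow> (\<forall>i. \<bar>i\<bar> \<le> int R \<longrightarrow> x i = y i)"

text \<open>Coordinate 0 suffices: commutation with the shift gives the other coordinates.\<close>

definition has_radius :: "(int \<Rightarrow> 'a) set \<Rightarrow> ((int \<Rightarrow> 'a) \<Rightarrow> (int \<Rightarrow> 'b)) \<Rightarrow> nat \<Rightarrow> bool" where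
  "has_radius X f R \<longleftrightarrow> (\<forall>x\<in>X. \<forall>y\<in>X. agree R x y \<longrightarrow> f x 0 = f y 0)"

lemma agree_mono: "agree R x y \<Longrightarrow> S \<le> R \<Longrightarrow> agree S x y"
  by (auto simp: agree_def)

lemma has_radius_mono: "has_radius X f R \<Longrightarrow> R \<le> S \<Longrightarrow> has_radius X f S"
  unfolding has_radius_def using agree_mono by blast

lemma openin_agree: "openin full_shift_topology {y. agree R x y}"
proof -
  have "{y. agree R x y} = {y. \<forall>i\<in>{- int R..int R}. y i \<in> {x i}}"
    by (auto simp: agree_def abs_le_iff)
  then show ?thesis
    using openin_full_shift_cylinder[of "{- int R..int R}" "\<lambda>i. {x i}"] by simp
qed

lemma openin_full_shift_agree:
  assumes "openin full_shift_topology T" and "x \<in> T"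
  shows "\<exists>R. \<forall>y. agree R x y \<longrightarrow> y \<in> T"
proof -
  obtain U where U: "finite {i. U i \<noteq> UNIV}" "x \<in> Pi\<^sub>E UNIV U" "Pi\<^sub>E UNIV U \<subseteq> T"
    using assms unfolding full_shift_topology_def openin_product_topology_alt by auto
  \<comment> \<open>The farthest restricted coordinate, or 0 if none is restricted.\<close>
  define R where "R = Max (insert 0 ((\<lambda>i. nat \<bar>i\<bar>) ` {i. U i \<noteq> UNIV}))"
  have R: "\<bar>i\<bar> \<le> int R" if "U i \<noteq> UNIV" for i
  proof -
    have "nat \<bar>i\<bar> \<le> R"
      unfolding R_def using U(1) that by (intro Max_ge) auto
    then show ?thesis by simp
  qed
  have "y \<in> T" if "agree R x y" for y
  proof -
    have "y i \<in> U i" for i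
      using U(2) R[of i] that by (cases "U i = UNIV") (simp_all add: agree_def PiE_iff, metis)
    then have "y \<in> Pi\<^sub>E UNIV U"
      by (simp add: PiE_iff)
    then show ?thesis using U(3) by blast
  qed
  then show ?thesis by blast
qed

text \<open>The Curtis-Hedlund-Lyndon theorem: continuity gives a radius at each point, and
  compactness of \<open>X\<close> leaves finitely many radii, whose maximum works
  everywhere.\<close>

lemma block_map_has_radius:
  fixes f :: "(int \<Rightarrow> 'a::finite) \<Rightarrow> (int \<Rightarrow> 'b)"
  assumes X: "closedin full_shift_topology X" and f: "block_map X Y f"
  shows "\<exists>R. has_radius X f R"
proof -
  have cont: "continuous_map (subtopology full_shift_topology X) full_shift_topology f"
    using f by (simp add: block_map_def continuous_map_in_subtopology)
  have "\<exists>R. \<forall>y\<in>X. agree R x y \<longrightarrow> f y 0 = f x 0" if x: "x \<in> X" for x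
  proof -
    have "openin full_shift_topology {z. \<forall>i\<in>{0}. z i \<in> {f x i}}"
      by (rule openin_full_shift_cylinder) simp
    then have "openin (subtopology full_shift_topology X) {y \<in> X. f y 0 = f x 0}"
      using openin_continuous_map_preimage[OF cont] by fastforce
    then obtain T where T: "openin full_shift_topology T" "{y \<in> X. f y 0 = f x 0} = T \<inter> X"
      by (auto simp: openin_subtopology)
    then have "x \<in> T" using x by blast
    then obtain R where "\<forall>y. agree R x y \<longrightarrow> y \<in> T"
      using openin_full_shift_agree[OF T(1)] by blast
    then show ?thesis using T(2) by blast
  qed
  then obtain r where r: "\<And>x y. x \<in> X \<Longrightarrow> y \<in> X \<Longrightarrow> agree (r x) x y \<Longrightarrow> f y 0 = f x 0"
    by metis
  let ?\<U> = "(\<lambda>x. {y. agree (r x) x y}) ` X"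
  have "compactin full_shift_topology X"
    using X compact_full_shift by (rule closedin_compact_space[rotated])
  moreover have "X \<subseteq> \<Union>?\<U>"
    by (auto simp: agree_def)
  moreover have "\<And>U. U \<in> ?\<U> \<Longrightarrow> openin full_shift_topology U"
    using openin_agree by blast
  ultimately have "\<exists>\<F>. finite \<F> \<and> \<F> \<subseteq> ?\<U> \<and> X \<subseteq> \<Union>\<F>"
    by (intro compactinD)
  then obtain \<F> where \<F>: "finite \<F>" "\<F> \<subseteq> ?\<U>" "X \<subseteq> \<Union>\<F>"
    by blast
  obtain F where F: "finite F" "F \<subseteq> X" "\<F> = (\<lambda>x. {y. agree (r x) x y}) ` F"
    using finite_subset_image[OF \<F>(1,2)] by blast
  define R where "R = Max (insert 0 (r ` F))"
  have rR: "r x \<le> R" if "x \<in> F" for x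
    unfolding R_def using F(1) that by (intro Max_ge) auto
  have "f y 0 = f z 0" if yz: "y \<in> X" "z \<in> X" "agree R y z" for y z
  proof -
    obtain x where x: "x \<in> F" "agree (r x) x y"
      using \<F>(3) F(3) yz(1) by auto
    \<comment> \<open>Since \<open>r x \<le> R\<close>, \<open>z\<close> lies in the same cylinder
      around \<open>x\<close> as \<open>y\<close>, so both values are \<open>f x 0\<close>.\<close>
    moreover have "agree (r x) x z"
      using x(2) agree_mono[OF yz(3) rR[OF x(1)]] by (auto simp: agree_def)
    ultimately show ?thesis
      using r F(2) yz by (metis subsetD)
  qed
  then show ?thesis
    unfolding has_radius_def by blast
qed

lemma block_map_shift_power:
  assumes f: "block_map X Y f" and X: "\<And>x k. x \<in> X \<Longrightarrow> shift_power k x \<in> X" and x: "x \<in> X"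
  shows "f (shift_power k x) = shift_power k (f x)"
proof -
  have step: "f (shift_power 1 z) = shift_power 1 (f z)" if "z \<in> X" for z
    using f that by (simp add: block_map_def shift_power_1)
  show ?thesis
  proof (induction k rule: int_induct[where k = 0])
    case base
    show ?case by (simp add: shift_power_0)
  next
    case (step1 i)
    have "f (shift_power 1 (shift_power i x)) = shift_power 1 (shift_power i (f x))"
      using step[OF X[OF x, of i]] step1(2) by simp
    then show ?case by (simp add: shift_power_def algebra_simps)
  next
    case (step2 i)
    \<comment> \<open>Downwards, commutation is applied at the earlier point and the shift is then
      undone.\<close>
    have "f (shift_power 1 (shift_power (i - 1) x)) = shift_power 1 (f (shift_power (i - 1) x))"
      by (rule step[OF X[OF x]])
    then have "shift_power i (f x) = shift_power 1 (f (shift_power (i - 1) x))"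
      using step2(2) by (simp add: shift_power_def algebra_simps)
    then have "shift_power (- 1) (shift_power i (f x)) = f (shift_power (i - 1) x)"
      by (simp add: shift_power_def)
    then show ?case by (simp add: shift_power_def algebra_simps)
  qed
qed

lemma block_map_in:
  assumes "block_map X Y f" and "x \<in> X"
  shows "f x \<in> Y"
  using assms by (auto simp: block_map_def continuous_map_def Pi_iff)

lemma block_map_local:
  assumes f: "block_map X Y f" and X: "\<And>x k. x \<in> X \<Longrightarrow> shift_power k x \<in> X"
    and R: "has_radius X f R" and "x \<in> X" "y \<in> X"
    and eq: "\<And>t. \<bar>t\<bar> \<le> int R \<Longrightarrow> x (i + t) = y (j + t)"
  shows "f x i = f y j"
proof -
  have "agree R (shift_power i x) (shift_power j y)"
    using eq by (auto simp: agree_def shift_power_def algebra_simps)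
  then have "f (shift_power i x) 0 = f (shift_power j y) 0"
    using R X assms(4,5) unfolding has_radius_def by blast
  then have "shift_power i (f x) 0 = shift_power j (f y) 0"
    using block_map_shift_power[OF f X] assms(4,5) by simp
  then show ?thesis by (simp add: shift_power_def)
qed

section \<open>Counting block maps up to the shift\<close>

text \<open>There are \<open>card F * m\<close> pairs but at most
  \<open>C * L = 2 * C * K * m\<close> words. The factor \<open>m\<close> cancels, so the bound does
  not depend on the radius of the maps in \<open>F\<close>.\<close>

lemma card_inequivalent_block_maps_le:
  fixes F :: "((int \<Rightarrow> 'a::finite) \<Rightarrow> (int \<Rightarrow> 'b)) set"
  assumes X: "\<And>x k. x \<in> X \<Longrightarrow> shift_power k x \<in> X" and closed: "closedin full_shift_topology X"
    and Y: "\<And>y k. y \<in> Y \<Longrightarrow> shift_power k y \<in> Y"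
    and K: "\<And>W x y. W \<ge> 1 \<Longrightarrow> x \<in> X \<Longrightarrow> y \<in> X \<Longrightarrow> sublist (window y 0 W) (window x 0 (K * W))"
    and fin: "\<And>L. finite ((\<lambda>y. window y 0 L) ` Y)"
    and C: "\<And>L. L \<ge> 1 \<Longrightarrow> card ((\<lambda>y. window y 0 L) ` Y) \<le> C * L"
    and aper: "\<And>y c. y \<in> Y \<Longrightarrow> shift_power c y = y \<Longrightarrow> c = 0"
    and x: "x \<in> X"
    and F: "finite F" "\<And>f. f \<in> F \<Longrightarrow> block_map X Y f"
    and ineq: "\<And>f g. f \<in> F \<Longrightarrow> g \<in> F \<Longrightarrow> f \<noteq> g \<Longrightarrow> \<not> shift_equivalent X f g"
  shows "card F \<le> 2 * C * K"
proof (rule ccontr)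
  assume "\<not> card F \<le> 2 * C * K"
  obtain r where r: "\<And>f. f \<in> F \<Longrightarrow> has_radius X f (r f)"
    using block_map_has_radius[OF closed] F(2) by metis
  define R where "R = Max (insert 0 (r ` F))"
  have R: "has_radius X f R" if "f \<in> F" for f
    by (rule has_radius_mono[OF r[OF that]]) (use F(1) that in \<open>auto simp: R_def\<close>)
  define m where "m = 2 * R + 1"
  \<comment> \<open>Values at offsets below \<open>m\<close> depend on coordinates within
    \<open>R\<close> of them, which span \<open>2 * R + m = 2 * m - 1\<close> places.\<close>
  define W where "W = 2 * m"
  define L where "L = K * W"
  have "sublist (window x 0 W) (window x 0 L)"
    unfolding L_def by (intro K x) (simp add: W_def m_def)
  then have "W \<le> L"
    using sublist_length_le by fastforce
  then have L: "L \<ge> 1" by (simp add: W_def m_def)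
  let ?\<phi> = "\<lambda>(f, k). window (shift_power (int k) (f x)) 0 L"
  have im: "?\<phi> ` (F \<times> {..<m}) \<subseteq> (\<lambda>y. window y 0 L) ` Y"
    using Y block_map_in[OF F(2) x] by auto
  have "\<not> inj_on ?\<phi> (F \<times> {..<m})"
  proof
    assume "inj_on ?\<phi> (F \<times> {..<m})"
    then have "card (F \<times> {..<m}) \<le> card ((\<lambda>y. window y 0 L) ` Y)"
      using card_inj_on_le im fin by blast
    also have "\<dots> \<le> C * L"
      by (rule C[OF L])
    finally have "card F * m \<le> (2 * C * K) * m"
      by (simp add: L_def W_def card_cartesian_product algebra_simps)
    then have "card F \<le> 2 * C * K"
      by (subst (asm) mult_le_cancel2) (simp add: m_def)
    then show False
      using \<open>\<not> card F \<le> 2 * C * K\<close> by simp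
  qed
  then obtain f k g l where fg: "f \<in> F" "g \<in> F" "k < m" "l < m" "(f, k) \<noteq> (g, l)"
    and eq: "window (shift_power (int k) (f x)) 0 L = window (shift_power (int l) (g x)) 0 L"
    unfolding inj_on_def by auto
  have eqx: "f x (int t + int k) = g x (int t + int l)" if "t < L" for t
    using arg_cong[OF eq, of "\<lambda>w. w ! t"] that by (simp add: window_def shift_power_def)
  have eqz: "f z (j + int k) = g z (j + int l)" if z: "z \<in> X" for z j
  proof -
    \<comment> \<open>Starting \<open>R\<close> places before \<open>j\<close>, the window of length
      \<open>W\<close> shows everything that decides the two values in question.\<close>
    let ?z = "shift_power (j - int R) z"
    have "sublist (window ?z 0 W) (window x 0 L)"
      unfolding L_def by (intro K x X z) (simp add: W_def m_def)
    then obtain ps ss where ps: "window x 0 L = ps @ window ?z 0 W @ ss"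
      by (auto simp: sublist_def)
    define s where "s = length ps"
    have sL: "s + W \<le> L"
      using arg_cong[OF ps, of length] by (simp add: s_def)
    have x_z: "x (int (s + t)) = z (j - int R + int t)" if "t < W" for t
    proof -
      have "window x 0 L ! (s + t) = window ?z 0 W ! t"
        using that by (simp add: ps s_def nth_append)
      then show ?thesis
        using that sL by (simp add: window_def shift_power_def algebra_simps)
    qed
    \<comment> \<open>The displacement from \<open>z\<close> to \<open>x\<close> is the same for
      both maps and both offsets, so the coincidence along \<open>x\<close> carries over to
      \<open>z\<close>.\<close>
    have transfer: "h z (j + int q) = h x (int (s + R) + int q)" if h: "h \<in> F" and q: "q < m" for h q
    proof (rule block_map_local[OF F(2)[OF h] X R[OF h] z x])
      fix t assume t: "\<bar>t\<bar> \<le> int R"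
      have "x (int (s + nat (int R + int q + t))) = z (j - int R + int (nat (int R + int q + t)))"
        by (rule x_z) (use t q in \<open>simp add: W_def m_def\<close>)
      moreover have "int (nat (int R + int q + t)) = int R + int q + t"
        using t by simp
      ultimately show "z (j + int q + t) = x (int (s + R) + int q + t)"
        by (simp add: algebra_simps)
    qed
    have "s + R < L"
      using sL by (simp add: W_def m_def)
    then show ?thesis
      using transfer[OF fg(1,3)] transfer[OF fg(2,4)] eqx[of "s + R"] by simp
  qed
  have equiv: "f z = shift_power (int l - int k) (g z)" if "z \<in> X" for z
  proof
    fix i show "f z i = shift_power (int l - int k) (g z) i"
      using eqz[OF that, of "i - int k"] by (simp add: shift_power_def algebra_simps)
  qed
  then have "shift_equivalent X f g"
    unfolding shift_equivalent_def by blast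
  then have "f = g"
    using ineq fg(1,2) by blast
  \<comment> \<open>With \<open>f = g\<close>, the point \<open>f x\<close> of \<open>Y\<close> is
    fixed by the power \<open>l - k\<close> of the shift; then \<open>k = l\<close>, against the
    choice of distinct pairs.\<close>
  moreover from this have "int l - int k = 0"
    using aper[OF block_map_in[OF F(2)[OF fg(1)] x]] equiv[OF x] by metis
  ultimately show False
    using fg(5) by simp
qed

text \<open>A pairwise inequivalent subset of greatest cardinality works: an element related to none
  of its members could be added.\<close>

lemma finite_representatives:
  fixes N :: nat
  assumes sym: "\<And>f g. E f g \<Longrightarrow> E g f" and refl: "\<And>f. E f f"
    and bound: "\<And>P. finite P \<Longrightarrow> P \<subseteq> A \<Longrightarrow> \<forall>f\<in>P. \<forall>g\<in>P. f \<noteq> g \<longrightarrow> \<not> E f g \<Longrightarrow> card P \<le> N"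
  shows "\<exists>P\<subseteq>A. finite P \<and> (\<forall>f\<in>A. \<exists>g\<in>P. E f g)"
proof -
  let ?Q = "\<lambda>P. finite P \<and> P \<subseteq> A \<and> (\<forall>f\<in>P. \<forall>g\<in>P. f \<noteq> g \<longrightarrow> \<not> E f g)"
  have "\<exists>P. ?Q P \<and> (\<forall>P'. ?Q P' \<longrightarrow> card P' \<le> card P)"
  proof (rule ex_has_greatest_nat)
    show "?Q {}" by simp
    show "\<forall>P. ?Q P \<longrightarrow> card P < Suc N"
      using bound by (simp add: less_Suc_eq_le)
  qed
  then obtain P where P: "?Q P" "\<And>P'. ?Q P' \<Longrightarrow> card P' \<le> card P"
    by metis
  have "\<exists>g\<in>P. E f g" if f: "f \<in> A" for f
  proof (rule ccontr)
    assume no: "\<not> (\<exists>g\<in>P. E f g)"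
    then have "f \<notin> P" using refl by blast
    moreover have "?Q (insert f P)"
      using P(1) f no sym by blast
    then have "card (insert f P) \<le> card P"
      by (rule P(2))
    ultimately show False using P(1) by simp
  qed
  then show ?thesis using P(1) by (intro exI[of _ P]) simp
qed

theorem theorem2:
  fixes \<tau> :: "'a::finite list \<Rightarrow> 'a list"
    and \<rho> :: "'b::finite list \<Rightarrow> 'b list"
    and r :: real
  assumes "substitution \<tau>" and "primitive_subst \<tau>" and "aperiodic_subst \<tau>" and "balanced_growth \<tau>"
    and "substitution \<rho>" and "primitive_subst \<rho>" and "aperiodic_subst \<rho>" and "balanced_growth \<rho>"
    and "dominant_eigenvalue (subst_matrix \<tau>) r"
    and "dominant_eigenvalue (subst_matrix \<rho>) r"
    and "r > 1"
  shows "\<exists>P :: ((int \<Rightarrow> 'a) \<Rightarrow> (int \<Rightarrow> 'b)) set.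
           finite P \<and>
           (\<forall>g\<in>P. block_map (two_sided_subshift \<tau>) (two_sided_subshift \<rho>) g) \<and>
           (\<forall>f. block_map (two_sided_subshift \<tau>) (two_sided_subshift \<rho>) f \<longrightarrow>
              (\<exists>g\<in>P. \<exists>k::int. \<forall>x\<in>two_sided_subshift \<tau>. f x = (shift_power k \<circ> g) x))"
proof -
  interpret t: primitive_substitution \<tau>
    using assms by unfold_locales
  interpret r: primitive_substitution \<rho>
    using assms by unfold_locales
  let ?X = "two_sided_subshift \<tau>" and ?Y = "two_sided_subshift \<rho>"
  obtain K where K: "\<And>W x y. W \<ge> 1 \<Longrightarrow> x \<in> ?X \<Longrightarrow> y \<in> ?X \<Longrightarrow>
      sublist (window y 0 W) (window x 0 (K * W))"
    using t.linear_recurrence by blast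
  obtain C where C: "\<And>L. L \<ge> 1 \<Longrightarrow> card ((\<lambda>y. window y 0 L) ` ?Y) \<le> C * L"
    using r.linear_complexity by blast
  have "\<exists>N. \<forall>P. finite P \<longrightarrow> P \<subseteq> {f. block_map ?X ?Y f} \<longrightarrow>
      (\<forall>f\<in>P. \<forall>g\<in>P. f \<noteq> g \<longrightarrow> \<not> shift_equivalent ?X f g) \<longrightarrow> card P \<le> N"
  proof (cases "?X = {}")
    case True
    \<comment> \<open>Without points all maps are equivalent, so an inequivalent set has at most one
      element.\<close>
    then have "shift_equivalent ?X f g" for f g :: "(int \<Rightarrow> 'a) \<Rightarrow> (int \<Rightarrow> 'b)"
      by (simp add: shift_equivalent_def)
    then show ?thesis
      by (intro exI[of _ 1]) (auto simp: card_le_Suc0_iff_eq)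
  next
    case False
    then obtain x where x: "x \<in> ?X" by blast
    show ?thesis
    proof (intro exI allI impI)
      fix P assume "finite P" "P \<subseteq> {f. block_map ?X ?Y f}"
        "\<forall>f\<in>P. \<forall>g\<in>P. f \<noteq> g \<longrightarrow> \<not> shift_equivalent ?X f g"
      then show "card P \<le> 2 * C * K"
        by (intro card_inequivalent_block_maps_le[where X = ?X and Y = ?Y and x = x]
            closedin_two_sided_subshift shift_power_two_sided_subshift
            K r.finite_windows C r.two_sided_aperiodic[OF assms(7)] x) auto
    qed
  qed
  then obtain N where N: "\<And>P. finite P \<Longrightarrow> P \<subseteq> {f. block_map ?X ?Y f} \<Longrightarrow>
      \<forall>f\<in>P. \<forall>g\<in>P. f \<noteq> g \<longrightarrow> \<not> shift_equivalent ?X f g \<Longrightarrow> card P \<le> N"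
    by blast
  have "shift_equivalent ?X f f" for f :: "(int \<Rightarrow> 'a) \<Rightarrow> (int \<Rightarrow> 'b)"
    unfolding shift_equivalent_def by (intro exI[of _ 0]) (simp add: shift_power_0)
  then obtain P where P: "P \<subseteq> {f. block_map ?X ?Y f}" "finite P"
      "\<forall>f\<in>{f. block_map ?X ?Y f}. \<exists>g\<in>P. shift_equivalent ?X f g"
    using finite_representatives[of "shift_equivalent ?X" "{f. block_map ?X ?Y f}" N]
      shift_equivalent_sym N by metis
  then show ?thesis
    unfolding shift_equivalent_def comp_apply by (intro exI[of _ P]) auto
qed

end
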